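(* Let $\alpha\vDash n$. Then \[\mathcal H\mathfrak S^*_\alpha(X,Y)=\sum_S\tilde Q_{\mathrm{comp}(\mathrm{Des}_{\mathfrak S^*}(S))}(X,Y),\] where the sum is over all standard immaculate tableaux $S$ of shape $\alpha$.
   Context: Let $\mathcal A=\{1,\dots,\ell\}$ and $\mathcal A'=\{1',\dots,k'\}$ with total order $1<2<\dots<\ell<1'<2'<\dots<k'$, and variables $X=(x_1,\dots,x_\ell)$, $Y=(y_1,\dots,y_k)$, with $z_i=x_i$ for $i\in\mathcal A$ and $z_{i'}=y_i$. A semistandard hook immaculate tableau of shape $\alpha$ is a filling of the diagram of $\alpha$ ($\alpha_i$ left-justified boxes in row $i$, row 1 at bottom) with entries in $\mathcal A\cup\mathcal A'$ such that the first column increases bottom to top, strictly for entries in $\mathcal A$ and weakly for entries in $\mathcal A'$, and each row increases left to right, weakly for entries in $\mathcal A$ and strictly for entries in $\mathcal A'$. The hook dual immaculate function is $\mathcal H\mathfrak S^*_\alpha(X,Y)=\sum_T\prod_{a\in\mathcal A\cup\mathcal A'}z_a^{\#\{a\text{'s in }T\}}$ over all such $T$. For $\beta\vDash n$, $\tilde Q_\beta(X,Y)=\sum z_{a_1}\cdots z_{a_n}$ over $a_1\le\dots\le a_n$ in $\mathcal A\cup\mathcal A'$ such that $a_i=a_{i+1}\in\mathcal A\Rightarrow i\notin\mathrm{set}(\beta)$ and $a_i=a_{i+1}\in\mathcal A'\Rightarrow i\in\mathrm{set}(\beta)$, where $\mathrm{set}(\beta)=\{\beta_1,\beta_1+\beta_2,\dots,\beta_1+\dots+\beta_{\ell(\beta)-1}\}$.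 A standard immaculate tableau of shape $\alpha$ is a filling with $1,\dots,n$ each once, leftmost column increasing bottom to top and rows increasing left to right; $\mathrm{Des}_{\mathfrak S^*}(S)=\{i: i+1\text{ is strictly above } i\text{ in }S\}$; $\mathrm{comp}$ is the inverse of $\mathrm{set}$. *)

theory Defs
  imports "HOL-Library.Poly_Mapping" "HOL-Library.FuncSet"
begin

section \<open>The ordered alphabet and the polynomial ring\<close>

text \<open>\<open>Unprimed i\<close> is the letter \<open>i\<close> and \<open>Primed j\<close> is the letter \<open>j'\<close>.\<close>

datatype letter = Unprimed nat | Primed nat

instantiation letter :: linorder
begin

fun less_eq_letter :: "letter \<Rightarrow> letter \<Rightarrow> bool" where
  "Unprimed i \<le> Unprimed j \<longleftrightarrow> i \<le> j"
| "Unprimed i \<le> Primed j \<longleftrightarrow> True"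
| "Primed i \<le> Unprimed j \<longleftrightarrow> False"
| "Primed i \<le> Primed j \<longleftrightarrow> i \<le> j"

definition less_letter :: "letter \<Rightarrow> letter \<Rightarrow> bool" where
  "less_letter a b \<longleftrightarrow> a \<le> b \<and> \<not> b \<le> a"

instance
proof
  fix a b c :: letter
  show "a < b \<longleftrightarrow> a \<le> b \<and> \<not> b \<le> a"
    by (rule less_letter_def)
  show "a \<le> a"
    by (cases a) simp_all
  show "a \<le> b \<Longrightarrow> b \<le> c \<Longrightarrow> a \<le> c"
    by (cases a; cases b; cases c) simp_all
  show "a \<le> b \<Longrightarrow> b \<le> a \<Longrightarrow> a = b"
    by (cases a; cases b) simp_all
  show "a \<le> b \<or> b \<le> a"
    by (cases a; cases b) (simp_all add: linear)
qed

end

definition unprimed_letters :: "nat \<Rightarrow> letter set" where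
  "unprimed_letters l = Unprimed ` {1..l}"

definition primed_letters :: "nat \<Rightarrow> letter set" where
  "primed_letters k = Primed ` {1..k}"

definition alphabet :: "nat \<Rightarrow> nat \<Rightarrow> letter set" where
  "alphabet l k = unprimed_letters l \<union> primed_letters k"

text \<open>
  Polynomials are finitely supported maps from exponent vectors to coefficients.
  The indeterminates are indexed by letters, so that \<open>x\<^sub>i = zvar (Unprimed i)\<close> and
  \<open>y\<^sub>j = zvar (Primed j)\<close>.
\<close>

type_synonym 'c mpoly = "(letter \<Rightarrow>\<^sub>0 nat) \<Rightarrow>\<^sub>0 'c"

definition zvar :: "letter \<Rightarrow> 'c::comm_ring_1 mpoly" where
  "zvar a = Poly_Mapping.single (Poly_Mapping.single a 1) 1"

section \<open>Compositions\<close>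

definition compositions :: "nat \<Rightarrow> nat list set" where
  "compositions n = {\<beta>. (\<forall>b \<in> set \<beta>. 0 < b) \<and> sum_list \<beta> = n}"

definition comp_set :: "nat list \<Rightarrow> nat set" where
  "comp_set \<beta> = {sum_list (take j \<beta>) | j. 1 \<le> j \<and> j < length \<beta>}"

text \<open>
  \<open>comp_set\<close> is a bijection from the compositions of \<open>n\<close> onto the subsets of \<open>{1..<n}\<close>,
  but it is not injective on all compositions, so its inverse takes \<open>n\<close> as a parameter.
\<close>

definition comp_of_set :: "nat \<Rightarrow> nat set \<Rightarrow> nat list" where
  "comp_of_set n = the_inv_into (compositions n) comp_set"

section \<open>Tableaux\<close>

text \<open>
  The box \<open>(r, c)\<close> lies in row \<open>r\<close> and column \<open>c\<close>, both counted from \<open>0\<close>; row \<open>0\<close> is at the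
  bottom. Fillings are extensional functions on the diagram, so that the sets of tableaux
  below are finite and distinct elements are distinct tableaux.
\<close>

definition diagram :: "nat list \<Rightarrow> (nat \<times> nat) set" where
  "diagram \<alpha> = {(r, c). r < length \<alpha> \<and> c < \<alpha> ! r}"

definition semistandard_hook_immaculate_tableaux ::
    "nat \<Rightarrow> nat \<Rightarrow> nat list \<Rightarrow> (nat \<times> nat \<Rightarrow> letter) set" where
  "semistandard_hook_immaculate_tableaux l k \<alpha> =
    {T \<in> diagram \<alpha> \<rightarrow>\<^sub>E alphabet l k.
      (\<forall>r r'. (r, 0) \<in> diagram \<alpha> \<and> (r', 0) \<in> diagram \<alpha> \<and> r < r' \<longrightarrow>
         T (r, 0) \<le> T (r', 0) \<and> (T (r, 0) = T (r', 0) \<longrightarrow> T (r, 0) \<in> primed_letters k)) \<and>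
      (\<forall>r c c'. (r, c) \<in> diagram \<alpha> \<and> (r, c') \<in> diagram \<alpha> \<and> c < c' \<longrightarrow>
         T (r, c) \<le> T (r, c') \<and> (T (r, c) = T (r, c') \<longrightarrow> T (r, c) \<in> unprimed_letters l))}"

definition standard_immaculate_tableaux :: "nat list \<Rightarrow> (nat \<times> nat \<Rightarrow> nat) set" where
  "standard_immaculate_tableaux \<alpha> =
    {S \<in> diagram \<alpha> \<rightarrow>\<^sub>E {1..sum_list \<alpha>}.
      bij_betw S (diagram \<alpha>) {1..sum_list \<alpha>} \<and>
      (\<forall>r r'. (r, 0) \<in> diagram \<alpha> \<and> (r', 0) \<in> diagram \<alpha> \<and> r < r' \<longrightarrow> S (r, 0) < S (r', 0)) \<and>
      (\<forall>r c c'. (r, c) \<in> diagram \<alpha> \<and> (r, c') \<in> diagram \<alpha> \<and> c < c' \<longrightarrow> S (r, c) < S (r, c'))}"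

definition Des :: "nat list \<Rightarrow> (nat \<times> nat \<Rightarrow> nat) \<Rightarrow> nat set" where
  "Des \<alpha> S = {i. \<exists>r c r' c'. (r, c) \<in> diagram \<alpha> \<and> (r', c') \<in> diagram \<alpha> \<and>
                    S (r, c) = i \<and> S (r', c') = i + 1 \<and> r < r'}"

section \<open>The two families of functions\<close>

definition hook_dual_immaculate :: "nat \<Rightarrow> nat \<Rightarrow> nat list \<Rightarrow> 'c::comm_ring_1 mpoly" where
  "hook_dual_immaculate l k \<alpha> =
    (\<Sum>T \<in> semistandard_hook_immaculate_tableaux l k \<alpha>.
       \<Prod>a \<in> alphabet l k. zvar a ^ card {b \<in> diagram \<alpha>. T b = a})"

definition Q_words :: "nat \<Rightarrow> nat \<Rightarrow> nat list \<Rightarrow> (nat \<Rightarrow> letter) set" where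
  "Q_words l k \<beta> =
    {a \<in> {1..sum_list \<beta>} \<rightarrow>\<^sub>E alphabet l k.
      \<forall>i \<in> {1..<sum_list \<beta>}.
        a i \<le> a (i + 1) \<and>
        (a i = a (i + 1) \<and> a i \<in> unprimed_letters l \<longrightarrow> i \<notin> comp_set \<beta>) \<and>
        (a i = a (i + 1) \<and> a i \<in> primed_letters k \<longrightarrow> i \<in> comp_set \<beta>)}"

definition Q_tilde :: "nat \<Rightarrow> nat \<Rightarrow> nat list \<Rightarrow> 'c::comm_ring_1 mpoly" where
  "Q_tilde l k \<beta> = (\<Sum>a \<in> Q_words l k \<beta>. \<Prod>i = 1..sum_list \<beta>. zvar (a i))"

end

theory Submission
  imports Defs "HOL-Library.Product_Lexorder"
begin

text \<open>
  A semistandard tableau \<open>T\<close> is standardized by ordering the boxes by their entries, breaking ties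
  between equal unprimed letters from top to bottom (and left to right within a row) and ties
  between equal primed letters from bottom to top. If \<open>S\<close> is the resulting standard tableau and
  \<open>a\<close> is the word of entries of \<open>T\<close> read in this order, then \<open>T = a \<circ> S\<close>, and the equal adjacent
  letters of \<open>a\<close> obey the descent conditions of \<open>Q_words\<close>. Conversely, these conditions force \<open>S\<close>
  to be the standardization of \<open>a \<circ> S\<close>, so that \<open>(S, a) \<mapsto> a \<circ> S\<close> is a weight-preserving bijection.
\<close>

section \<open>Compositions and sets of partial sums\<close>

lemma comp_set_Nil [simp]: "comp_set [] = {}"
  by (auto simp: comp_set_def)

lemma comp_set_singleton [simp]: "comp_set [b] = {}"
  by (auto simp: comp_set_def)

text \<open>\<open>comp_set\<close> omits the total sum, so \<open>b\<close> is a partial sum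
  exactly because some part follows it; all later partial sums are those of \<beta> shifted by
  \<open>b\<close>. Both inductions below peel off the first part this way.\<close>

lemma comp_set_Cons:
  assumes "\<beta> \<noteq> []"
  shows "comp_set (b # \<beta>) = insert b ((+) b ` comp_set \<beta>)"
proof (intro equalityI subsetI)
  fix x assume "x \<in> comp_set (b # \<beta>)"
  then obtain j where j: "x = sum_list (take j (b # \<beta>))" "1 \<le> j" "j < length (b # \<beta>)"
    by (auto simp: comp_set_def)
  then obtain i where i: "j = Suc i"
    by (cases j) auto
  show "x \<in> insert b ((+) b ` comp_set \<beta>)"
  proof (cases "i = 0")
    case False
    then have "sum_list (take i \<beta>) \<in> comp_set \<beta>"
      using j i unfolding comp_set_def by (intro CollectI exI[of _ i]) auto
    then show ?thesis
      using j i by auto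
  qed (use j i in simp)
next
  fix x assume "x \<in> insert b ((+) b ` comp_set \<beta>)"
  then consider "x = b" | y where "y \<in> comp_set \<beta>" "x = b + y"
    by auto
  then show "x \<in> comp_set (b # \<beta>)"
  proof cases
    case 1
    then show ?thesis
      using assms unfolding comp_set_def by (intro CollectI exI[of _ 1]) auto
  next
    case 2
    then obtain j where "y = sum_list (take j \<beta>)" "1 \<le> j" "j < length \<beta>"
      by (auto simp: comp_set_def)
    with 2 show ?thesis
      unfolding comp_set_def by (intro CollectI exI[of _ "Suc j"]) auto
  qed
qed

lemma comp_set_pos:
  assumes "\<forall>b \<in> set \<beta>. 0 < b" "x \<in> comp_set \<beta>"
  shows "0 < x"
  using assms
proof (induction \<beta> arbitrary: x)
  case (Cons b \<beta>)
  then show ?case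
    by (cases "\<beta> = []") (auto simp: comp_set_Cons)
qed simp

text \<open>With at least two parts, the first part is the least element of \<open>comp_set\<close>,
  so it can be read off and removed. A single part is determined by the sum.\<close>

lemma comp_set_inject:
  assumes "\<forall>b \<in> set \<beta>. 0 < b" "\<forall>c \<in> set \<gamma>. 0 < c"
    and "sum_list \<beta> = sum_list \<gamma>" "comp_set \<beta> = comp_set \<gamma>"
  shows "\<beta> = \<gamma>"
  using assms
proof (induction \<beta> arbitrary: \<gamma>)
  case Nil
  then show ?case
    by (cases \<gamma>) auto
next
  case (Cons b \<beta>)
  then obtain c \<delta> where \<gamma>: "\<gamma> = c # \<delta>"
    by (cases \<gamma>) auto
  show ?case
  proof (cases "\<beta> = [] \<or> \<delta> = []")
    case True
    then show ?thesis
      using Cons.prems \<gamma> by (cases "\<beta> = []"; cases "\<delta> = []") (auto simp: comp_set_Cons)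
  next
    case False
    \<comment> \<open>Positivity makes \<open>b\<close> strictly smaller than every shifted partial
      sum. This gives \<open>b = c\<close>, and then allows cancelling it from both sides of the set
      equation.\<close>
    have above: "b < x" if "x \<in> (+) b ` comp_set \<beta>" for x
      using that comp_set_pos[of \<beta>] Cons.prems(1) by force
    have above': "c < x" if "x \<in> (+) c ` comp_set \<delta>" for x
      using that comp_set_pos[of \<delta>] Cons.prems(2) \<gamma> by force
    have eq: "insert b ((+) b ` comp_set \<beta>) = insert c ((+) c ` comp_set \<delta>)"
      using Cons.prems(4) False \<gamma> by (simp add: comp_set_Cons)
    have bc: "b = c"
      using eq above above' by (metis insertE insertI1 less_asym)
    then have "(+) b ` comp_set \<beta> = (+) b ` comp_set \<delta>"
      using eq above above' by (metis insert_ident less_irrefl)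
    then have "comp_set \<beta> = comp_set \<delta>"
      by (simp add: inj_image_eq_iff)
    then have "\<beta> = \<delta>"
      using Cons.prems \<gamma> bc by (intro Cons.IH) auto
    then show ?thesis
      using bc \<gamma> by simp
  qed
qed

text \<open>Strong induction: the least element \<open>m\<close> of \<open>D\<close> becomes the
  first part, and the other elements, lowered by \<open>m\<close>, form a subset of
  \<open>{1..<n - m}\<close>.\<close>

lemma comp_set_surj:
  assumes "D \<subseteq> {1..<n}"
  shows "\<exists>\<beta> \<in> compositions n. comp_set \<beta> = D"
  using assms
proof (induction n arbitrary: D rule: less_induct)
  case (less n)
  show ?case
  proof (cases "D = {}")
    case True
    then show ?thesis
      \<comment> \<open>Parts must be positive, so \<open>[0]\<close> is no composition of
        0.\<close>
      by (intro bexI[of _ "if n = 0 then [] else [n]"]) (auto simp: compositions_def)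
  next
    case False
    have fin: "finite D"
      using less.prems finite_subset by blast
    define m where "m = Min D"
    have m: "m \<in> D" "\<And>x. x \<in> D \<Longrightarrow> m \<le> x"
      using fin False by (auto simp: m_def)
    then have mn: "0 < m" "m < n"
      using less.prems by (auto dest: subsetD)
    define D' where "D' = (\<lambda>x. x - m) ` (D - {m})"
    have "D' \<subseteq> {1..<n - m}"
      using less.prems m mn by (fastforce simp: D'_def)
    then obtain \<beta> where \<beta>: "\<beta> \<in> compositions (n - m)" "comp_set \<beta> = D'"
      using less.IH[of "n - m" D'] mn by auto
    then have "\<beta> \<noteq> []"
      using mn by (auto simp: compositions_def)
    moreover have "(+) m ` D' = D - {m}"
      using m(2) by (force simp: D'_def image_image)
    ultimately have "comp_set (m # \<beta>) = D"
      using \<beta>(2) m(1) by (auto simp: comp_set_Cons)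
    then show ?thesis
      using \<beta>(1) mn by (intro bexI[of _ "m # \<beta>"]) (auto simp: compositions_def)
  qed
qed

lemma inj_on_comp_set: "inj_on comp_set (compositions n)"
  by (auto simp: inj_on_def compositions_def intro: comp_set_inject)

text \<open>\<open>Q_words\<close> depends on a composition only through its \<open>comp_set\<close>
  and its sum, so these two facts suffice for handling \<open>comp_of_set\<close>.\<close>

lemma
  assumes "D \<subseteq> {1..<n}"
  shows comp_set_comp_of_set: "comp_set (comp_of_set n D) = D"
    and sum_list_comp_of_set: "sum_list (comp_of_set n D) = n"
proof -
  have D: "D \<in> comp_set ` compositions n"
    using comp_set_surj[OF assms] by auto
  show "comp_set (comp_of_set n D) = D"
    unfolding comp_of_set_def using inj_on_comp_set D by (rule f_the_inv_into_f)
  show "sum_list (comp_of_set n D) = n"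
    using the_inv_into_into[OF inj_on_comp_set D order_refl]
    by (simp add: comp_of_set_def compositions_def)
qed

section \<open>Ranks in a finite linear order\<close>

text \<open>The sets counted are initial segments, hence nested. If \<open>f p < f q\<close>, then
  \<open>q\<close> lies in the larger one only.\<close>

lemma rank_less_iff:
  fixes f :: "'a \<Rightarrow> 'b::linorder"
  assumes "finite A" "p \<in> A" "q \<in> A"
  shows "card {x \<in> A. f x \<le> f p} < card {x \<in> A. f x \<le> f q} \<longleftrightarrow> f p < f q"
proof
  assume "f p < f q"
  then have "{x \<in> A. f x \<le> f p} \<subset> {x \<in> A. f x \<le> f q}"
    using assms(3) by (intro psubsetI subsetI notI) (auto simp: set_eq_iff dest: spec[of _ q])
  then show "card {x \<in> A. f x \<le> f p} < card {x \<in> A. f x \<le> f q}"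
    using assms(1) by (intro psubset_card_mono) auto
next
  assume less: "card {x \<in> A. f x \<le> f p} < card {x \<in> A. f x \<le> f q}"
  show "f p < f q"
  proof (rule ccontr)
    assume "\<not> f p < f q"
    then have "card {x \<in> A. f x \<le> f q} \<le> card {x \<in> A. f x \<le> f p}"
      using assms(1) by (intro card_mono) auto
    with less show False
      by simp
  qed
qed

text \<open>Equal ranks exclude both strict comparisons, so ranks are injective on \<open>A\<close>;
  surjectivity onto \<open>{1..card A}\<close> follows by counting.\<close>

lemma bij_betw_rank:
  fixes f :: "'a \<Rightarrow> 'b::linorder"
  assumes "finite A" "inj_on f A"
  shows "bij_betw (\<lambda>p. card {x \<in> A. f x \<le> f p}) A {1..card A}"
proof -
  let ?r = "\<lambda>p. card {x \<in> A. f x \<le> f p}"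
  have inj: "inj_on ?r A"
  proof (rule inj_onI)
    fix p q assume "p \<in> A" "q \<in> A" "?r p = ?r q"
    then have "f p = f q"
      using rank_less_iff[OF assms(1), of p q f] rank_less_iff[OF assms(1), of q p f] by auto
    then show "p = q"
      using assms(2) \<open>p \<in> A\<close> \<open>q \<in> A\<close> by (auto dest: inj_onD)
  qed
  moreover have "?r ` A \<subseteq> {1..card A}"
  proof
    fix y assume "y \<in> ?r ` A"
    then obtain p where p: "p \<in> A" "y = ?r p"
      by auto
    then have "0 < ?r p"
      using assms(1) by (subst card_gt_0_iff) auto
    moreover have "?r p \<le> card A"
      using assms(1) by (intro card_mono) auto
    ultimately show "y \<in> {1..card A}"
      using p by auto
  qed
  ultimately have "?r ` A = {1..card A}"
    by (intro card_subset_eq) (auto simp: card_image)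
  with inj show ?thesis
    by (simp add: bij_betw_def)
qed

text \<open>A numbering along which \<open>f\<close> increases has no freedom: linearity turns
  \<open>mono\<close> into an equivalence, so the initial segments of \<open>S\<close> and
  \<open>f\<close> coincide, and that of \<open>S\<close> at \<open>p\<close> has \<open>S p\<close>
  elements. This later recovers a standard tableau from its semistandard image.\<close>

lemma rank_unique:
  fixes f :: "'a \<Rightarrow> 'b::linorder"
  assumes S: "bij_betw S A {1..n::nat}" and "p \<in> A"
    and mono: "\<And>p q. p \<in> A \<Longrightarrow> q \<in> A \<Longrightarrow> S p < S q \<Longrightarrow> f p < f q"
  shows "S p = card {x \<in> A. f x \<le> f p}"
proof -
  have "f x \<le> f p \<longleftrightarrow> S x \<le> S p" if "x \<in> A" for x
  proof
    show "f x \<le> f p \<Longrightarrow> S x \<le> S p"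
      using mono[of p x] that assms(2) by force
    show "S x \<le> S p \<Longrightarrow> f x \<le> f p"
      using mono[of x p] that assms(2) S
      by (metis bij_betw_imp_inj_on inj_onD le_less)
  qed
  then have eq: "{x \<in> A. f x \<le> f p} = {x \<in> A. S x \<le> S p}"
    by auto
  have "S ` {x \<in> A. S x \<le> S p} = {1..S p}"
  proof (intro equalityI subsetI)
    fix i assume i: "i \<in> {1..S p}"
    moreover have "S p \<in> {1..n}"
      using bij_betwE[OF S] assms(2) by blast
    ultimately have "i \<in> {1..n}"
      by auto
    then obtain x where "x \<in> A" "i = S x"
      using S unfolding bij_betw_def by blast
    with i show "i \<in> S ` {x \<in> A. S x \<le> S p}"
      by auto
  qed (use S in \<open>auto dest: bij_betwE\<close>)
  moreover have "inj_on S {x \<in> A. S x \<le> S p}"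
    using S by (auto simp: bij_betw_def intro: inj_on_subset)
  ultimately have "card {x \<in> A. S x \<le> S p} = card {1..S p}"
    by (metis card_image)
  then show ?thesis
    by (simp add: eq)
qed

section \<open>Standardization\<close>

lemma diagram_Sigma: "diagram \<alpha> = (SIGMA r:{..<length \<alpha>}. {..<\<alpha> ! r})"
  by (auto simp: diagram_def)

lemma finite_diagram [simp]: "finite (diagram \<alpha>)"
  by (simp add: diagram_Sigma)

lemma card_diagram: "card (diagram \<alpha>) = sum_list \<alpha>"
  by (simp add: diagram_Sigma sum_list_sum_nth atLeast0LessThan)

lemma finite_alphabet [simp]: "finite (alphabet l k)"
  by (simp add: alphabet_def unprimed_letters_def primed_letters_def)

lemma alphabet_Unprimed_iff: "Unprimed i \<in> alphabet l k \<longleftrightarrow> Unprimed i \<in> unprimed_letters l"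
  by (auto simp: alphabet_def unprimed_letters_def primed_letters_def)

lemma alphabet_Primed_iff: "Primed i \<in> alphabet l k \<longleftrightarrow> Primed i \<in> primed_letters k"
  by (auto simp: alphabet_def unprimed_letters_def primed_letters_def)

lemma Unprimed_notin_primed_letters [simp]: "Unprimed i \<notin> primed_letters k"
  by (auto simp: primed_letters_def)

lemma Primed_notin_unprimed_letters [simp]: "Primed i \<notin> unprimed_letters l"
  by (auto simp: unprimed_letters_def)

text \<open>The lexicographic order on these triples is the standardization order. Rows are integers
  so that negation can put higher rows first among equal unprimed letters; the column separates
  boxes with the same letter and row.\<close>

definition box_key :: "(nat \<times> nat \<Rightarrow> letter) \<Rightarrow> nat \<times> nat \<Rightarrow> letter \<times> int \<times> nat" where
  "box_key T p =
    (T p, case T p of Unprimed _ \<Rightarrow> - int (fst p) | Primed _ \<Rightarrow> int (fst p), snd p)"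

lemma box_key_less_iff:
  "box_key T p < box_key T q \<longleftrightarrow> T p < T q \<or> T p = T q \<and>
    (case T p of Unprimed _ \<Rightarrow> fst q < fst p | Primed _ \<Rightarrow> fst p < fst q) \<or>
    T p = T q \<and> fst p = fst q \<and> snd p < snd q"
  by (auto simp: box_key_def less_prod_def' split: letter.splits)

lemma inj_on_box_key: "inj_on (box_key T) A"
  by (rule inj_onI) (auto simp: box_key_def prod_eq_iff split: letter.splits)

lemma box_key_cong: "T p = T' p \<Longrightarrow> box_key T p = box_key T' p"
  by (simp add: box_key_def)

section \<open>Descents and rows of standard immaculate tableaux\<close>

lemma standard_bij:
  "S \<in> standard_immaculate_tableaux \<alpha> \<Longrightarrow> bij_betw S (diagram \<alpha>) {1..sum_list \<alpha>}"
  by (simp add: standard_immaculate_tableaux_def)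

lemma Des_subset:
  assumes "S \<in> standard_immaculate_tableaux \<alpha>"
  shows "Des \<alpha> S \<subseteq> {1..<sum_list \<alpha>}"
proof
  fix i assume "i \<in> Des \<alpha> S"
  then obtain p q where "p \<in> diagram \<alpha>" "q \<in> diagram \<alpha>" "S p = i" "S q = i + 1"
    by (auto simp: Des_def)
  then have "i \<in> {1..sum_list \<alpha>}" "i + 1 \<in> {1..sum_list \<alpha>}"
    using bij_betwE[OF standard_bij[OF assms]] by metis+
  then show "i \<in> {1..<sum_list \<alpha>}"
    by auto
qed

text \<open>Injectivity of \<open>S\<close> makes the boxes holding two consecutive values unique,
  so the existential in \<open>Des\<close> can be tested on the given ones.\<close>

lemma Des_iff:
  assumes "S \<in> standard_immaculate_tableaux \<alpha>" "p \<in> diagram \<alpha>" "q \<in> diagram \<alpha>" "S q = S p + 1"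
  shows "S p \<in> Des \<alpha> S \<longleftrightarrow> fst p < fst q"
proof
  have inj: "inj_on S (diagram \<alpha>)"
    using standard_bij[OF assms(1)] by (simp add: bij_betw_def)
  assume "S p \<in> Des \<alpha> S"
  then obtain p' q' where "p' \<in> diagram \<alpha>" "q' \<in> diagram \<alpha>" "S p' = S p" "S q' = S p + 1"
    "fst p' < fst q'"
    by (auto simp: Des_def)
  with inj show "fst p < fst q"
    using assms(2-4) by (metis inj_onD)
next
  assume "fst p < fst q"
  then show "S p \<in> Des \<alpha> S"
    using assms(2-4) unfolding Des_def
    by (intro CollectI exI[of _ "fst p"] exI[of _ "snd p"] exI[of _ "fst q"] exI[of _ "snd q"]) auto
qed

lemma standard_row_less:
  assumes "S \<in> standard_immaculate_tableaux \<alpha>" "p \<in> diagram \<alpha>" "q \<in> diagram \<alpha>"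
    and "fst p = fst q" "S p < S q"
  shows "snd p < snd q"
proof (rule ccontr)
  assume "\<not> snd p < snd q"
  then consider "p = q" | "snd q < snd p"
    using assms(4) by (metis linorder_neqE_nat prod_eqI)
  then show False
  proof cases
    case 2
    have "\<forall>r c c'. (r, c) \<in> diagram \<alpha> \<and> (r, c') \<in> diagram \<alpha> \<and> c < c' \<longrightarrow> S (r, c) < S (r, c')"
      using assms(1) by (simp add: standard_immaculate_tableaux_def)
    then have "S q < S p"
      using 2 assms(2-4) by (metis prod.collapse)
    with assms(5) show False
      by simp
  qed (use assms(5) in simp)
qed

section \<open>Words compatible with the descents of a standard tableau\<close>

definition descent_words :: "nat \<Rightarrow> nat \<Rightarrow> nat list \<Rightarrow> (nat \<times> nat \<Rightarrow> nat) \<Rightarrow> (nat \<Rightarrow> letter) set" where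
  "descent_words l k \<alpha> S = Q_words l k (comp_of_set (sum_list \<alpha>) (Des \<alpha> S))"

text \<open>Descents lie in \<open>{1..<sum_list \<alpha>}\<close>, so \<open>comp_set\<close>
  undoes \<open>comp_of_set\<close> and compositions disappear from the conditions.\<close>

lemma descent_words_iff:
  assumes "S \<in> standard_immaculate_tableaux \<alpha>"
  shows "a \<in> descent_words l k \<alpha> S \<longleftrightarrow> a \<in> {1..sum_list \<alpha>} \<rightarrow>\<^sub>E alphabet l k \<and>
    (\<forall>i \<in> {1..<sum_list \<alpha>}. a i \<le> a (i + 1) \<and>
      (a i = a (i + 1) \<and> a i \<in> unprimed_letters l \<longrightarrow> i \<notin> Des \<alpha> S) \<and>
      (a i = a (i + 1) \<and> a i \<in> primed_letters k \<longrightarrow> i \<in> Des \<alpha> S))"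
  using Des_subset[OF assms]
  by (simp add: descent_words_def Q_words_def comp_set_comp_of_set sum_list_comp_of_set)

text \<open>This extends the conditions on neighbouring letters to any two boxes. The word increases
  weakly, so equal end letters force all letters between to be equal. If unprimed, no step is a
  descent and the rows never go up; if primed, every step is a descent and the rows go strictly
  up.\<close>

lemma word_chain:
  assumes S: "S \<in> standard_immaculate_tableaux \<alpha>" and a: "a \<in> descent_words l k \<alpha> S"
    and "p \<in> diagram \<alpha>" "q \<in> diagram \<alpha>" "S p < S q"
  shows "a (S p) \<le> a (S q) \<and> (a (S p) = a (S q) \<longrightarrow>
    (case a (S p) of Unprimed _ \<Rightarrow> fst q \<le> fst p | Primed _ \<Rightarrow> fst p < fst q))"
  using assms(3-5)
proof (induction "S q" arbitrary: q)
  case (Suc i)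
  have bij: "bij_betw S (diagram \<alpha>) {1..sum_list \<alpha>}"
    using standard_bij[OF S] .
  have "S p \<in> {1..sum_list \<alpha>}" "S q \<in> {1..sum_list \<alpha>}"
    using bij_betwE[OF bij] Suc.prems by blast+
  then have i: "i \<in> {1..<sum_list \<alpha>}"
    using Suc.hyps(2) Suc.prems(3) by auto
  then have "i \<in> S ` diagram \<alpha>"
    using bij by (auto simp: bij_betw_def)
  \<comment> \<open>\<open>u\<close> is the predecessor of \<open>q\<close> in the numbering; the
    claim for \<open>p\<close> and \<open>u\<close> is chained with the single step from
    \<open>u\<close> to \<open>q\<close>.\<close>
  then obtain u where u: "u \<in> diagram \<alpha>" "S u = i"
    by auto
  have "a i \<in> alphabet l k"
    using a i by (auto simp: descent_words_iff[OF S])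
  then have mem: "case a i of Unprimed _ \<Rightarrow> a i \<in> unprimed_letters l
      | Primed _ \<Rightarrow> a i \<in> primed_letters k"
    by (auto split: letter.split simp: alphabet_Unprimed_iff alphabet_Primed_iff)
  have des: "i \<in> Des \<alpha> S \<longleftrightarrow> fst u < fst q"
    using Des_iff[OF S u(1) Suc.prems(2)] u(2) Suc.hyps(2) by simp
  have word: "a i \<le> a (S q)"
    "a i = a (S q) \<Longrightarrow> a i \<in> unprimed_letters l \<Longrightarrow> i \<notin> Des \<alpha> S"
    "a i = a (S q) \<Longrightarrow> a i \<in> primed_letters k \<Longrightarrow> i \<in> Des \<alpha> S"
    using a i unfolding descent_words_iff[OF S] Suc.hyps(2)[symmetric] Suc_eq_plus1 by blast+
  have step: "a i \<le> a (S q)" "a i = a (S q) \<Longrightarrow>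
      (case a i of Unprimed _ \<Rightarrow> fst q \<le> fst u | Primed _ \<Rightarrow> fst u < fst q)"
    using word mem des by (auto split: letter.splits)
  show ?case
  proof (cases "S p = i")
    case True
    then have "p = u"
      using u Suc.prems(1) bij by (metis bij_betw_def inj_onD)
    then show ?thesis
      using step unfolding True by metis
  next
    case False
    then have "S p < S u"
      using u Suc.hyps(2) Suc.prems(3) by simp
    then have IH: "a (S p) \<le> a i" "a (S p) = a i \<Longrightarrow>
        (case a (S p) of Unprimed _ \<Rightarrow> fst u \<le> fst p | Primed _ \<Rightarrow> fst p < fst u)"
      using Suc.hyps(1)[of u] u Suc.prems(1) by auto
    show ?thesis
    proof (intro conjI impI)
      show "a (S p) \<le> a (S q)"
        using IH(1) step(1) by simp
      assume "a (S p) = a (S q)"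
      then have "a (S p) = a i" "a i = a (S q)"
        using IH(1) step(1) by auto
      then show "case a (S p) of Unprimed _ \<Rightarrow> fst q \<le> fst p | Primed _ \<Rightarrow> fst p < fst q"
        using IH(2) step(2) by (auto split: letter.splits)
    qed
  qed
qed simp

text \<open>Ties between equal letters are settled by \<open>word_chain\<close>, and within one row
  by \<open>standard_row_less\<close>. With \<open>rank_unique\<close>, this identifies
  \<open>S\<close> as the standardization of \<open>a \<circ> S\<close>.\<close>

lemma box_key_less_of_standard:
  assumes "S \<in> standard_immaculate_tableaux \<alpha>" "a \<in> descent_words l k \<alpha> S"
    and "p \<in> diagram \<alpha>" "q \<in> diagram \<alpha>" "S p < S q"
  shows "box_key (a \<circ> S) p < box_key (a \<circ> S) q"
proof (cases "a (S p) = a (S q)")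
  case True
  then show ?thesis
    using word_chain[OF assms] standard_row_less[OF assms(1,3,4) _ assms(5)]
    by (cases "a (S q)") (auto simp: box_key_less_iff)
next
  case False
  then show ?thesis
    using word_chain[OF assms] by (simp add: box_key_less_iff)
qed

section \<open>The bijection between pairs (S, a) and semistandard tableaux\<close>

definition assemble ::
    "nat list \<Rightarrow> (nat \<times> nat \<Rightarrow> nat) \<times> (nat \<Rightarrow> letter) \<Rightarrow> nat \<times> nat \<Rightarrow> letter" where
  "assemble \<alpha> = (\<lambda>(S, a). restrict (a \<circ> S) (diagram \<alpha>))"

text \<open>Going up the first column, the row index grows, which \<open>word_chain\<close> forbids
  for equal unprimed letters. Along a row it is constant, which is forbidden for equal primed
  letters.\<close>

lemma assemble_semistandard:
  assumes S: "S \<in> standard_immaculate_tableaux \<alpha>" and a: "a \<in> descent_words l k \<alpha> S"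
  shows "assemble \<alpha> (S, a) \<in> semistandard_hook_immaculate_tableaux l k \<alpha>"
proof -
  have mem: "a (S p) \<in> alphabet l k" if "p \<in> diagram \<alpha>" for p
    using a that bij_betwE[OF standard_bij[OF S]] by (auto simp: descent_words_iff[OF S])
  have col: "a (S (r, 0)) \<le> a (S (r', 0)) \<and>
      (a (S (r, 0)) = a (S (r', 0)) \<longrightarrow> a (S (r, 0)) \<in> primed_letters k)"
    if "(r, 0) \<in> diagram \<alpha>" "(r', 0) \<in> diagram \<alpha>" "r < r'" for r r'
  proof -
    have "S (r, 0) < S (r', 0)"
      using S that by (auto simp: standard_immaculate_tableaux_def)
    from word_chain[OF S a that(1,2) this] show ?thesis
      using mem[OF that(1)] that(3) by (auto split: letter.splits simp: alphabet_Primed_iff)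
  qed
  have row: "a (S (r, c)) \<le> a (S (r, c')) \<and>
      (a (S (r, c)) = a (S (r, c')) \<longrightarrow> a (S (r, c)) \<in> unprimed_letters l)"
    if "(r, c) \<in> diagram \<alpha>" "(r, c') \<in> diagram \<alpha>" "c < c'" for r c c'
  proof -
    have "S (r, c) < S (r, c')"
      using S that by (auto simp: standard_immaculate_tableaux_def)
    from word_chain[OF S a that(1,2) this] show ?thesis
      using mem[OF that(1)] by (auto split: letter.splits simp: alphabet_Unprimed_iff)
  qed
  show ?thesis
    unfolding semistandard_hook_immaculate_tableaux_def assemble_def
    using mem col row by (auto simp del: One_nat_def)
qed

text \<open>The common filling determines the box keys, and both \<open>S\<close> and
  \<open>S'\<close> are their rank function. Once \<open>S\<close> is known, every position of the
  word is hit by some box, so the filling determines \<open>a\<close>.\<close>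

lemma inj_on_assemble:
  "inj_on (assemble \<alpha>) (SIGMA S:standard_immaculate_tableaux \<alpha>. descent_words l k \<alpha> S)"
proof (rule inj_onI, clarify)
  fix S a S' a'
  assume S: "S \<in> standard_immaculate_tableaux \<alpha>" and a: "a \<in> descent_words l k \<alpha> S"
    and S': "S' \<in> standard_immaculate_tableaux \<alpha>" and a': "a' \<in> descent_words l k \<alpha> S'"
    and eq: "assemble \<alpha> (S, a) = assemble \<alpha> (S', a')"
  have eqT: "a (S p) = a' (S' p)" if "p \<in> diagram \<alpha>" for p
    using fun_cong[OF eq, of p] that by (simp add: assemble_def)
  then have key: "box_key (a \<circ> S) p = box_key (a' \<circ> S') p" if "p \<in> diagram \<alpha>" for p
    using that by (intro box_key_cong) simp
  have "S p = S' p" if "p \<in> diagram \<alpha>" for p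
  proof -
    have "S p = card {x \<in> diagram \<alpha>. box_key (a \<circ> S) x \<le> box_key (a \<circ> S) p}"
      using standard_bij[OF S] that box_key_less_of_standard[OF S a] by (rule rank_unique)
    also have "\<dots> = card {x \<in> diagram \<alpha>. box_key (a' \<circ> S') x \<le> box_key (a' \<circ> S') p}"
      using that by (intro arg_cong[where f = card]) (auto simp: key)
    also have "\<dots> = S' p"
      using standard_bij[OF S'] that box_key_less_of_standard[OF S' a']
      by (rule rank_unique[symmetric])
    finally show ?thesis .
  qed
  moreover have "S \<in> diagram \<alpha> \<rightarrow>\<^sub>E {1..sum_list \<alpha>}" "S' \<in> diagram \<alpha> \<rightarrow>\<^sub>E {1..sum_list \<alpha>}"
    using S S' unfolding standard_immaculate_tableaux_def by blast+
  ultimately have SS: "S = S'"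
    by (metis PiE_ext)
  have "a i = a' i" if "i \<in> {1..sum_list \<alpha>}" for i
  proof -
    have "i \<in> S ` diagram \<alpha>"
      using that standard_bij[OF S] by (simp add: bij_betw_def)
    then obtain p where "p \<in> diagram \<alpha>" "i = S p"
      by auto
    then show ?thesis
      using eqT SS by simp
  qed
  moreover have "a \<in> {1..sum_list \<alpha>} \<rightarrow>\<^sub>E alphabet l k" "a' \<in> {1..sum_list \<alpha>} \<rightarrow>\<^sub>E alphabet l k"
    using a a' unfolding descent_words_iff[OF S] descent_words_iff[OF S'] by blast+
  ultimately have "a = a'"
    by (metis PiE_ext)
  with SS show "S = S' \<and> a = a'"
    by simp
qed

text \<open>Take for \<open>S\<close> the rank of each box under \<open>box_key T\<close>, and for
  \<open>a\<close> the entries of \<open>T\<close> read in that order.\<close>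

lemma assemble_surj:
  assumes T: "T \<in> semistandard_hook_immaculate_tableaux l k \<alpha>"
  shows "\<exists>S \<in> standard_immaculate_tableaux \<alpha>. \<exists>a \<in> descent_words l k \<alpha> S. assemble \<alpha> (S, a) = T"
proof -
  let ?D = "diagram \<alpha>" and ?n = "sum_list \<alpha>"
  have TE: "T \<in> ?D \<rightarrow>\<^sub>E alphabet l k"
    and col: "\<And>r r'. (r, 0) \<in> ?D \<Longrightarrow> (r', 0) \<in> ?D \<Longrightarrow> r < r' \<Longrightarrow>
      T (r, 0) \<le> T (r', 0) \<and> (T (r, 0) = T (r', 0) \<longrightarrow> T (r, 0) \<in> primed_letters k)"
    and row: "\<And>r c c'. (r, c) \<in> ?D \<Longrightarrow> (r, c') \<in> ?D \<Longrightarrow> c < c' \<Longrightarrow>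
      T (r, c) \<le> T (r, c') \<and> (T (r, c) = T (r, c') \<longrightarrow> T (r, c) \<in> unprimed_letters l)"
    using T unfolding semistandard_hook_immaculate_tableaux_def by blast+
  define S where "S = restrict (\<lambda>p. card {x \<in> ?D. box_key T x \<le> box_key T p}) ?D"
  have bij: "bij_betw S ?D {1..?n}"
    using bij_betw_rank[OF finite_diagram inj_on_box_key, of \<alpha> T]
    by (subst bij_betw_cong[where g = "\<lambda>p. card {x \<in> ?D. box_key T x \<le> box_key T p}"])
      (simp_all add: S_def card_diagram)
  have less: "S p < S q \<longleftrightarrow> box_key T p < box_key T q" if "p \<in> ?D" "q \<in> ?D" for p q
    using rank_less_iff[OF finite_diagram that, of "box_key T"] that by (simp add: S_def)
  \<comment> \<open>Equal entries in the first column are primed, and the key orders these from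
    bottom to top.\<close>
  have "S (r, 0) < S (r', 0)" if "(r, 0) \<in> ?D" "(r', 0) \<in> ?D" "r < r'" for r r'
    using col[OF that] that(3) unfolding less[OF that(1,2)]
    by (cases "T (r', 0)") (auto simp: box_key_less_iff le_less)
  \<comment> \<open>Equal entries in one row agree in the first two key components, so the column
    decides.\<close>
  moreover have "S (r, c) < S (r, c')" if "(r, c) \<in> ?D" "(r, c') \<in> ?D" "c < c'" for r c c'
    using row[OF that] that(3) unfolding less[OF that(1,2)]
    by (auto simp: box_key_less_iff le_less)
  moreover have "S \<in> ?D \<rightarrow>\<^sub>E {1..?n}"
    using bij_betwE[OF bij] by (auto simp: S_def)
  ultimately have S: "S \<in> standard_immaculate_tableaux \<alpha>"
    using bij unfolding standard_immaculate_tableaux_def by blast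
  define a where "a = restrict (\<lambda>i. T (the_inv_into ?D S i)) {1..?n}"
  have inj: "inj_on S ?D"
    using bij by (simp add: bij_betw_def)
  have aS: "a (S p) = T p" if "p \<in> ?D" for p
    using that bij_betwE[OF bij] by (simp add: a_def the_inv_into_f_f[OF inj])
  have ex: "\<exists>p \<in> ?D. S p = i" if "i \<in> {1..?n}" for i
    using that bij unfolding bij_betw_def by (metis imageE)
  have "a i \<in> alphabet l k" if i: "i \<in> {1..?n}" for i
    using ex[OF i] aS TE by fastforce
  then have a_alphabet: "a \<in> {1..?n} \<rightarrow>\<^sub>E alphabet l k"
    by (auto simp: a_def)
  have a_step: "a i \<le> a (i + 1) \<and>
      (a i = a (i + 1) \<and> a i \<in> unprimed_letters l \<longrightarrow> i \<notin> Des \<alpha> S) \<and>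
      (a i = a (i + 1) \<and> a i \<in> primed_letters k \<longrightarrow> i \<in> Des \<alpha> S)"
    if i: "i \<in> {1..<?n}" for i
  proof -
    obtain p q where pq: "p \<in> ?D" "q \<in> ?D" "S p = i" "S q = i + 1"
      using ex[of i] ex[of "i + 1"] i by auto
    have des: "i \<in> Des \<alpha> S \<longleftrightarrow> fst p < fst q"
      using Des_iff[OF S pq(1,2)] pq(3,4) by simp
    have key: "box_key T p < box_key T q"
      using less[OF pq(1,2)] pq(3,4) by simp
    \<comment> \<open>A tie within a row is no descent, so it would violate the condition for primed
      letters; the row condition on \<open>T\<close> makes such a tie unprimed.\<close>
    have same: "T p \<in> unprimed_letters l" if "T p = T q" "fst p = fst q" "snd p < snd q"
      using row[of "fst p" "snd p" "snd q"] pq that by (metis prod.collapse)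
    have "a i = T p" "a (i + 1) = T q"
      using aS pq by metis+
    then show ?thesis
      using key same unfolding des by (cases "T q") (auto simp: box_key_less_iff)
  qed
  have "a \<in> descent_words l k \<alpha> S"
    unfolding descent_words_iff[OF S] by (intro conjI[OF a_alphabet] ballI a_step)
  moreover have "assemble \<alpha> (S, a) = T"
  proof
    fix p
    show "assemble \<alpha> (S, a) p = T p"
      using aS[of p] PiE_arb[OF TE, of p] by (cases "p \<in> ?D") (simp_all add: assemble_def)
  qed
  ultimately show ?thesis
    using S by blast
qed

lemma bij_betw_assemble:
  "bij_betw (assemble \<alpha>) (SIGMA S:standard_immaculate_tableaux \<alpha>. descent_words l k \<alpha> S)
    (semistandard_hook_immaculate_tableaux l k \<alpha>)"
proof -
  have "assemble \<alpha> ` (SIGMA S:standard_immaculate_tableaux \<alpha>. descent_words l k \<alpha> S) =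
      semistandard_hook_immaculate_tableaux l k \<alpha>"
  proof (intro equalityI subsetI)
    fix T assume "T \<in> semistandard_hook_immaculate_tableaux l k \<alpha>"
    then obtain S a where "S \<in> standard_immaculate_tableaux \<alpha>" "a \<in> descent_words l k \<alpha> S"
      "T = assemble \<alpha> (S, a)"
      using assemble_surj by metis
    then show "T \<in> assemble \<alpha> ` (SIGMA S:standard_immaculate_tableaux \<alpha>. descent_words l k \<alpha> S)"
      by blast
  qed (auto simp: assemble_semistandard)
  with inj_on_assemble show ?thesis
    by (auto simp: bij_betw_def)
qed

section \<open>Comparison of the generating functions\<close>

text \<open>Collecting the boxes by their entry turns the product of powers into a product over
  boxes, which the bijection \<open>S\<close> reindexes by positions of the word.\<close>

lemma assemble_weight:
  assumes S: "S \<in> standard_immaculate_tableaux \<alpha>" and a: "a \<in> descent_words l k \<alpha> S"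
  shows "(\<Prod>x \<in> alphabet l k. (zvar x :: 'c::comm_ring_1 mpoly) ^
      card {b \<in> diagram \<alpha>. assemble \<alpha> (S, a) b = x}) = (\<Prod>i = 1..sum_list \<alpha>. zvar (a i))"
proof -
  let ?T = "assemble \<alpha> (S, a)"
  have "?T ` diagram \<alpha> \<subseteq> alphabet l k"
    using assemble_semistandard[OF assms] by (auto simp: semistandard_hook_immaculate_tableaux_def)
  then have "(\<Prod>b \<in> diagram \<alpha>. zvar (?T b) :: 'c mpoly) =
      (\<Prod>x \<in> alphabet l k. \<Prod>b \<in> {b \<in> diagram \<alpha>. ?T b = x}. zvar (?T b))"
    by (intro prod.group[OF finite_diagram finite_alphabet, symmetric])
  also have "\<dots> = (\<Prod>x \<in> alphabet l k. zvar x ^ card {b \<in> diagram \<alpha>. ?T b = x})"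
  proof (rule prod.cong[OF refl])
    fix x
    have "(\<Prod>b \<in> {b \<in> diagram \<alpha>. ?T b = x}. zvar (?T b) :: 'c mpoly) =
        (\<Prod>b \<in> {b \<in> diagram \<alpha>. ?T b = x}. zvar x)"
      by (rule prod.cong) auto
    then show "(\<Prod>b \<in> {b \<in> diagram \<alpha>. ?T b = x}. zvar (?T b) :: 'c mpoly) =
        zvar x ^ card {b \<in> diagram \<alpha>. ?T b = x}"
      by simp
  qed
  finally have "(\<Prod>x \<in> alphabet l k. (zvar x :: 'c mpoly) ^ card {b \<in> diagram \<alpha>. ?T b = x}) =
      (\<Prod>b \<in> diagram \<alpha>. zvar (?T b))" ..
  also have "\<dots> = (\<Prod>b \<in> diagram \<alpha>. zvar (a (S b)))"
    by (intro prod.cong) (auto simp: assemble_def)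
  also have "\<dots> = (\<Prod>i = 1..sum_list \<alpha>. zvar (a i))"
    using standard_bij[OF S] by (rule prod.reindex_bij_betw)
  finally show ?thesis .
qed

lemma finite_standard_immaculate_tableaux: "finite (standard_immaculate_tableaux \<alpha>)"
  unfolding standard_immaculate_tableaux_def
  by (rule finite_subset[OF Collect_restrict]) (simp add: finite_PiE)

lemma finite_Q_words: "finite (Q_words l k \<beta>)"
  unfolding Q_words_def
  by (rule finite_subset[OF Collect_restrict]) (simp add: finite_PiE)

theorem theorem5p7:
  fixes l k n :: nat and \<alpha> :: "nat list"
  assumes "\<alpha> \<in> compositions n"
  shows "(hook_dual_immaculate l k \<alpha> :: 'c::comm_ring_1 mpoly) =
    (\<Sum>S \<in> standard_immaculate_tableaux \<alpha>. Q_tilde l k (comp_of_set n (Des \<alpha> S)))"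
proof -
  have n: "n = sum_list \<alpha>"
    using assms by (simp add: compositions_def)
  let ?P = "SIGMA S:standard_immaculate_tableaux \<alpha>. descent_words l k \<alpha> S"
  let ?w = "\<lambda>T. \<Prod>x \<in> alphabet l k. (zvar x :: 'c mpoly) ^ card {b \<in> diagram \<alpha>. T b = x}"
  have "hook_dual_immaculate l k \<alpha> = (\<Sum>x \<in> ?P. ?w (assemble \<alpha> x))"
    unfolding hook_dual_immaculate_def
    using bij_betw_assemble by (rule sum.reindex_bij_betw[symmetric])
  also have "\<dots> = (\<Sum>(S, a) \<in> ?P. \<Prod>i = 1..n. zvar (a i))"
    by (intro sum.cong) (auto simp: assemble_weight n)
  also have "\<dots> = (\<Sum>S \<in> standard_immaculate_tableaux \<alpha>. \<Sum>a \<in> descent_words l k \<alpha> S.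
      \<Prod>i = 1..n. zvar (a i))"
    by (intro sum.Sigma[symmetric])
      (auto simp: finite_standard_immaculate_tableaux descent_words_def finite_Q_words)
  \<comment> \<open>The composition has sum \<open>n\<close>, so its words have positions
    \<open>1..n\<close> and the inner sum is \<open>Q_tilde\<close>.\<close>
  also have "\<dots> = (\<Sum>S \<in> standard_immaculate_tableaux \<alpha>. Q_tilde l k (comp_of_set n (Des \<alpha> S)))"
    using Des_subset
    by (intro sum.cong) (simp_all add: Q_tilde_def descent_words_def n sum_list_comp_of_set)
  finally show ?thesis .
qed

end
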